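(* Let the kernel pair $(M(x),K(x))$ belong to the Luchko set $\mathcal{L}_1(\mathbb{R}_+)$ and let $-\infty<a<b<+\infty$. Then the parametric general fractional integral and the parametric general fractional derivative of Caputo type satisfy the equalities $$(D^{(K),*}_{a+,g}\,I^{(M)}_{a+,g}f)(x)=f(x),$$ if $f\in C^1_{-1,g}(a,b]$ and $g\in\mathcal{G}(a,b]$, and $$(D^{(K),*}_{b-,g}\,I^{(M)}_{b-,g}f)(x)=f(x),$$ if $f\in C^1_{-1,g}[a,b)$ and $g\in\mathcal{G}[a,b)$.
   Context: Function classes. $\mathcal{G}(a,b]$ (resp. $\mathcal{G}[a,b)$) is the set of increasing and positive monotone functions $g$ on $(a,b)$ having a continuous first-order derivative $g^{(1)}$ on $(a,b]$ (resp. on $[a,b)$) such that $g^{(1)}(x)\ne0$ for all $x\in[a,b]$. $f\in C^1_{-1,g}(a,b]$ means that the first-order derivative of $f$ can be represented as $f^{(1)}(x)=(g(x)-g(a))^p\,v_p(x)$ with $v_p\in C[a,b]$ and $p>-1$. $f\in C^1_{-1,g}[a,b)$ means that $f^{(1)}(x)=(g(b)-g(x))^q\,v_q(x)$ with $v_q\in C[a,b]$ and $q>-1$. Kernels. The Luchko set $\mathcal{L}_1(\mathbb{R}_+)$ consists of the pairs $(M(x),K(x))$, $x\in\mathbb{R}_+=(0,\infty)$, such that $M,K\in C_{-1}(0,b-a]$ and the Sonin condition holds: $$\int_0^x M(x-z)K(z)\,dz=\begin{cases}1,& x\in(0,b-a],\\ 0,& x\notin(0,b-a].\end{cases}$$ Here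 $F\in C_{-1}(0,b-a]$ means $F(x)=x^pG(x)$ for some $G\in C[0,b-a]$ and $p>-1$. Operators. For $a<x\le b$ (left-sided) and $a\le x<b$ (right-sided): $$(I^{(M)}_{a+,g}f)(x)=\int_a^x M(g(x)-g(u))f(u)g^{(1)}(u)\,du,\qquad (I^{(M)}_{b-,g}f)(x)=\int_x^b M(g(u)-g(x))f(u)g^{(1)}(u)\,du,$$ $$(D^{(K),*}_{a+,g}f)(x)=\int_a^x K(g(x)-g(u))f^{(1)}(u)\,du,\qquad (D^{(K),*}_{b-,g}f)(x)=-\int_x^b K(g(u)-g(x))f^{(1)}(u)\,du.$$
   Formalization: The Sonin condition is taken on (0,l] with l arbitrary (no vanishing required beyond), and the equalities are claimed only where g(x)-g(a) ≤ l (left) or g(b)-g(x) ≤ l (right); with kernels tied to (0,b-a] they fail, e.g. for f=1 once g(x)-g(a) > b-a. *)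

theory Defs
  imports "HOL-Analysis.Analysis"
begin

(* At the endpoints of [a,b] derivatives are one-sided
   ("at x within {a..b}").  Nonvanishing of the derivative is required on all of [a,b], so the
   derivative has to exist also at the endpoint where its continuity is not required; in
   particular g is continuous on [a,b] and g a, g b are the boundary values of g. *)

definition G_left :: "real \<Rightarrow> real \<Rightarrow> (real \<Rightarrow> real) set" where
  "G_left a b = {g. mono_on {a<..<b} g \<and> (\<forall>x\<in>{a<..<b}. 0 < g x) \<and>
     (\<exists>g'. (\<forall>x\<in>{a..b}. (g has_real_derivative g' x) (at x within {a..b}) \<and> g' x \<noteq> 0) \<and>
           continuous_on {a<..b} g')}"

definition G_right :: "real \<Rightarrow> real \<Rightarrow> (real \<Rightarrow> real) set" where
  "G_right a b = {g. mono_on {a<..<b} g \<and> (\<forall>x\<in>{a<..<b}. 0 < g x) \<and>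
     (\<exists>g'. (\<forall>x\<in>{a..b}. (g has_real_derivative g' x) (at x within {a..b}) \<and> g' x \<noteq> 0) \<and>
           continuous_on {a..<b} g')}"

definition C1_left :: "(real \<Rightarrow> real) \<Rightarrow> real \<Rightarrow> real \<Rightarrow> (real \<Rightarrow> real) set" where
  "C1_left g a b = {f. \<exists>p v. p > -1 \<and> continuous_on {a..b} v \<and>
     (\<forall>x\<in>{a<..b}. (f has_real_derivative (g x - g a) powr p * v x) (at x within {a<..b}))}"

definition C1_right :: "(real \<Rightarrow> real) \<Rightarrow> real \<Rightarrow> real \<Rightarrow> (real \<Rightarrow> real) set" where
  "C1_right g a b = {f. \<exists>q v. q > -1 \<and> continuous_on {a..b} v \<and>
     (\<forall>x\<in>{a..<b}. (f has_real_derivative (g b - g x) powr q * v x) (at x within {a..<b}))}"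

definition C_minus1 :: "real \<Rightarrow> (real \<Rightarrow> real) set" where
  "C_minus1 l = {F. \<exists>p G. p > -1 \<and> continuous_on {0..l} G \<and> (\<forall>x\<in>{0<..l}. F x = x powr p * G x)}"

(* Kernel pairs on (0,l].  Only the values of M and K on (0,l] are constrained; the Sonin
   integral is therefore prescribed only for x in (0,l], and nothing is required beyond l. *)

definition Luchko_set :: "real \<Rightarrow> ((real \<Rightarrow> real) \<times> (real \<Rightarrow> real)) set" where
  "Luchko_set l = {(M, K). M \<in> C_minus1 l \<and> K \<in> C_minus1 l \<and>
     (\<forall>x\<in>{0<..l}. (LBINT z=ereal 0..ereal x. M (x - z) * K z) = 1)}"

definition gfi_left ::
  "(real \<Rightarrow> real) \<Rightarrow> (real \<Rightarrow> real) \<Rightarrow> real \<Rightarrow> (real \<Rightarrow> real) \<Rightarrow> real \<Rightarrow> real" where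
  "gfi_left M g a f x = (LBINT u=ereal a..ereal x. M (g x - g u) * f u * deriv g u)"

definition gfi_right ::
  "(real \<Rightarrow> real) \<Rightarrow> (real \<Rightarrow> real) \<Rightarrow> real \<Rightarrow> (real \<Rightarrow> real) \<Rightarrow> real \<Rightarrow> real" where
  "gfi_right M g b f x = (LBINT u=ereal x..ereal b. M (g u - g x) * f u * deriv g u)"

definition gfd_caputo_left ::
  "(real \<Rightarrow> real) \<Rightarrow> (real \<Rightarrow> real) \<Rightarrow> real \<Rightarrow> (real \<Rightarrow> real) \<Rightarrow> real \<Rightarrow> real" where
  "gfd_caputo_left K g a f x = (LBINT u=ereal a..ereal x. K (g x - g u) * deriv f u)"

definition gfd_caputo_right ::
  "(real \<Rightarrow> real) \<Rightarrow> (real \<Rightarrow> real) \<Rightarrow> real \<Rightarrow> (real \<Rightarrow> real) \<Rightarrow> real \<Rightarrow> real" where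
  "gfd_caputo_right K g b f x = - (LBINT u=ereal x..ereal b. K (g u - g x) * deriv f u)"

end

theory Submission
  imports Defs
begin

text \<open>
  The substitution \<open>t = g u - g a\<close> reduces the left-sided identity to one about convolutions on
  \<open>(0, X]\<close> with \<open>X = g x - g a\<close>.  There \<open>f\<close> becomes \<open>h = c + 1 * H\<close>, where \<open>H\<close> is the derivative
  of \<open>h\<close>.  By associativity and commutativity \<open>M * h = 1 * (c M + M * H)\<close>, so the
  fractional integral has derivative \<open>c M + M * H\<close>, and the Sonin condition \<open>K * M = 1\<close> gives
  \<open>K * (c M + M * H) = c + 1 * H = h\<close>.  All functions involved are continuous on \<open>(0, X]\<close> and integrable;
  such functions are closed under convolution, and Fubini's
  theorem gives associativity at every point, not only almost everywhere.
  The right-sided identity follows by replacing \<open>g\<close> with \<open>u \<mapsto> - g (- u)\<close>.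
\<close>

subsection \<open>Convolution of weakly singular kernels\<close>

text \<open>Integrating over the whole line makes reflection and translation invariance of
  \<open>lborel\<close> directly available; for factors that vanish outside \<open>{0<..X}\<close>
  only \<open>0 < t < y\<close> contributes.\<close>

definition conv :: "(real \<Rightarrow> real) \<Rightarrow> (real \<Rightarrow> real) \<Rightarrow> real \<Rightarrow> real" where
  "conv F H y = (\<integral>t. F (y - t) * H t \<partial>lborel)"

definition trunc :: "real \<Rightarrow> (real \<Rightarrow> real) \<Rightarrow> real \<Rightarrow> real" where
  "trunc X F t = indicator {0<..X} t * F t"

text \<open>Continuity away from 0 together with integrability admits every integrable singularity
  at 0. There are no exponents to track, which eases closure under convolution compared with
  \<open>C_minus1\<close>.\<close>

definition kernels :: "real \<Rightarrow> (real \<Rightarrow> real) set" where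
  "kernels X = {F. integrable lborel F \<and> continuous_on {0<..X} F \<and> (\<forall>t. t \<notin> {0<..X} \<longrightarrow> F t = 0)}"

lemma kernelsD:
  assumes "F \<in> kernels X"
  shows "integrable lborel F" "continuous_on {0<..X} F" "\<And>t. t \<le> 0 \<Longrightarrow> F t = 0"
    "\<And>t. X < t \<Longrightarrow> F t = 0" "F \<in> borel_measurable borel"
  using assms borel_measurable_integrable[of lborel F] by (auto simp: kernels_def)

lemma kernels_abs: "F \<in> kernels X \<Longrightarrow> (\<lambda>t. \<bar>F t\<bar>) \<in> kernels X"
  by (auto simp: kernels_def intro: continuous_intros)

lemma kernels_add:
  "F \<in> kernels X \<Longrightarrow> H \<in> kernels X \<Longrightarrow> (\<lambda>t. F t + H t) \<in> kernels X"
  by (auto simp: kernels_def intro: continuous_intros)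

lemma kernels_cmult: "F \<in> kernels X \<Longrightarrow> (\<lambda>t. c * F t) \<in> kernels X"
  by (auto simp: kernels_def intro: continuous_intros)

lemma kernels_one: "trunc X (\<lambda>_. 1) \<in> kernels X"
proof -
  have "continuous_on {0<..X} (trunc X (\<lambda>_. 1))"
    by (rule continuous_on_eq[of _ "\<lambda>_. 1"]) (auto simp: trunc_def)
  moreover have "integrable lborel (trunc X (\<lambda>_. 1))"
    using integrable_real_indicator[of "{0<..X}" lborel] by (cases "0 \<le> X") (auto simp: trunc_def[abs_def])
  ultimately show ?thesis by (auto simp: kernels_def trunc_def)
qed

lemma kernels_bounded_away:
  assumes F: "F \<in> kernels X" and "0 < d"
  obtains B where "B \<ge> 0" "\<And>t. d \<le> t \<Longrightarrow> \<bar>F t\<bar> \<le> B"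
proof -
  have "continuous_on {d..X} F"
    using kernelsD(2)[OF F] by (rule continuous_on_subset) (use \<open>0 < d\<close> in auto)
  hence "bounded (F ` {d..X})" by (intro compact_imp_bounded compact_continuous_image) auto
  then obtain B where "\<forall>z\<in>F ` {d..X}. norm z \<le> B" unfolding bounded_iff by blast
  hence B: "\<And>t. t \<in> {d..X} \<Longrightarrow> \<bar>F t\<bar> \<le> B" by simp
  show thesis
  proof
    show "max 0 B \<ge> 0" by simp
    fix t assume "d \<le> t"
    thus "\<bar>F t\<bar> \<le> max 0 B"
      using B[of t] kernelsD(4)[OF F, of t] by (cases "t \<le> X") auto
  qed
qed

section \<open>Convolution at every point: integrability and continuity\<close>

lemma integrable_reflect:
  fixes F :: "real \<Rightarrow> real"
  assumes "integrable lborel F" shows "integrable lborel (\<lambda>t. F (y - t))"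
  using lborel_integrable_real_affine[OF assms, of "-1" y] by simp

lemma integral_reflect:
  fixes F :: "real \<Rightarrow> real"
  shows "(\<integral>t. F (y - t) \<partial>lborel) = (\<integral>t. F t \<partial>lborel)"
  using lborel_integral_real_affine[of "-1" F y] by simp

lemma conv_commute: "conv F H y = conv H F y"
  unfolding conv_def using integral_reflect[of "\<lambda>t. F (y - t) * H t" y] by (simp add: mult.commute)

text \<open>One of \<open>t\<close> and \<open>y - t\<close> is at least \<open>y / 2\<close>, so
  one factor is bounded while the other is integrable. This works for each single \<open>y\<close>,
  as the later pointwise identities require.\<close>

lemma conv_integrable:
  assumes F: "F \<in> kernels X" and H: "H \<in> kernels X"
  shows "integrable lborel (\<lambda>t. F (y - t) * H t)"
proof (cases "y > 0")
  case False
  have "(\<lambda>t. F (y - t) * H t) = (\<lambda>_. 0)"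
  proof
    fix t show "F (y - t) * H t = 0"
      using kernelsD(3)[OF F, of "y - t"] kernelsD(3)[OF H, of t] False by (cases "t \<le> 0") auto
  qed
  thus ?thesis by simp
next
  case True
  obtain B where B: "B \<ge> 0" "\<And>t. y/2 \<le> t \<Longrightarrow> \<bar>F t\<bar> \<le> B"
    using kernels_bounded_away[OF F, of "y/2"] True by auto
  obtain C where C: "C \<ge> 0" "\<And>t. y/2 \<le> t \<Longrightarrow> \<bar>H t\<bar> \<le> C"
    using kernels_bounded_away[OF H, of "y/2"] True by auto
  note [measurable] = kernelsD(5)[OF F] kernelsD(5)[OF H]
  show ?thesis
  proof (rule Bochner_Integration.integrable_bound)
    show "integrable lborel (\<lambda>t. B * \<bar>H t\<bar> + C * \<bar>F (y - t)\<bar>)"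
      using kernelsD(1)[OF F] kernelsD(1)[OF H] by (auto intro!: integrable_reflect)
    show "(\<lambda>t. F (y - t) * H t) \<in> borel_measurable lborel" by measurable
    show "AE t in lborel. norm (F (y - t) * H t) \<le> norm (B * \<bar>H t\<bar> + C * \<bar>F (y - t)\<bar>)"
    proof (rule AE_I2)
      fix t
      have "\<bar>F (y - t)\<bar> * \<bar>H t\<bar> \<le> B * \<bar>H t\<bar> + C * \<bar>F (y - t)\<bar>"
      proof (cases "t \<le> y/2")
        case True
        hence "\<bar>F (y - t)\<bar> * \<bar>H t\<bar> \<le> B * \<bar>H t\<bar>" using B by (intro mult_right_mono) auto
        thus ?thesis using C by (simp add: add_increasing2)
      next
        case False
        hence "\<bar>H t\<bar> * \<bar>F (y - t)\<bar> \<le> C * \<bar>F (y - t)\<bar>" using C by (intro mult_right_mono) auto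
        thus ?thesis using B by (simp add: add_increasing mult.commute)
      qed
      thus "norm (F (y - t) * H t) \<le> norm (B * \<bar>H t\<bar> + C * \<bar>F (y - t)\<bar>)"
        using B C by (simp add: abs_mult)
    qed
  qed
qed

text \<open>
  Both factors may be singular at 0, so a single dominating function for the whole convolution
  is not available; splitting at \<open>y / 2\<close> keeps one factor bounded on each half.
\<close>
lemma half_conv_tendsto:
  assumes F: "F \<in> kernels X" and H: "H \<in> kernels X"
    and y: "0 < d" "\<And>n. d \<le> u n" "\<And>n. u n \<le> X" "d \<le> y" "y \<le> X" and u: "u \<longlonglongrightarrow> y"
  shows "(\<lambda>n. \<integral>t. indicator {..u n / 2} t * (F (u n - t) * H t) \<partial>lborel)
    \<longlonglongrightarrow> (\<integral>t. indicator {..y / 2} t * (F (y - t) * H t) \<partial>lborel)"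
proof -
  obtain B where B: "B \<ge> 0" "\<And>t. d/2 \<le> t \<Longrightarrow> \<bar>F t\<bar> \<le> B"
    using kernels_bounded_away[OF F, of "d/2"] y by auto
  note [measurable] = kernelsD(5)[OF F] kernelsD(5)[OF H]
  show ?thesis
  proof (rule integral_dominated_convergence[where w = "\<lambda>t. B * \<bar>H t\<bar>"])
    show "integrable lborel (\<lambda>t. B * \<bar>H t\<bar>)" using kernelsD(1)[OF H] by simp
    show "AE t in lborel. norm (indicator {..u n / 2} t * (F (u n - t) * H t)) \<le> B * \<bar>H t\<bar>" for n
    proof (rule AE_I2)
      fix t
      have "\<bar>F (u n - t)\<bar> * \<bar>H t\<bar> \<le> B * \<bar>H t\<bar>" if "t \<le> u n / 2"
        using that y(2)[of n] by (intro mult_right_mono B) auto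
      thus "norm (indicator {..u n / 2} t * (F (u n - t) * H t)) \<le> B * \<bar>H t\<bar>"
        using B by (auto simp: indicator_def abs_mult)
    qed
    \<comment> \<open>At \<open>t = y / 2\<close> the limiting indicator jumps and convergence can
      fail; this point is a null set.\<close>
    show "AE t in lborel. (\<lambda>n. indicator {..u n / 2} t * (F (u n - t) * H t))
        \<longlonglongrightarrow> indicator {..y / 2} t * (F (y - t) * H t)"
      using AE_lborel_singleton[of "y/2"]
    proof eventually_elim
      case (elim t)
      consider "t \<le> 0" | "0 < t" "t < y/2" | "y/2 < t" using elim by linarith
      thus ?case
      proof cases
        case 1
        thus ?thesis using kernelsD(3)[OF H] by simp
      next
        case 2
        have ev: "\<forall>\<^sub>F n in sequentially. 2 * t < u n"
          using order_tendstoD(1)[OF u, of "2 * t"] 2 by auto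
        have "(\<lambda>n. F (u n - t)) \<longlonglongrightarrow> F (y - t)"
        proof (rule continuous_on_tendsto_compose[OF kernelsD(2)[OF F]])
          show "(\<lambda>n. u n - t) \<longlonglongrightarrow> y - t" by (intro tendsto_intros u)
          show "y - t \<in> {0<..X}" using 2 y by auto
          show "\<forall>\<^sub>F n in sequentially. u n - t \<in> {0<..X}"
            using ev
          proof eventually_elim
            case (elim n)
            thus ?case using y(3)[of n] 2 by auto
          qed
        qed
        hence lim: "(\<lambda>n. F (u n - t) * H t) \<longlonglongrightarrow> F (y - t) * H t" by (intro tendsto_intros)
        have "\<forall>\<^sub>F n in sequentially.
            indicator {..u n / 2} t * (F (u n - t) * H t) = F (u n - t) * H t"
          using ev by eventually_elim auto
        hence "(\<lambda>n. indicator {..u n / 2} t * (F (u n - t) * H t)) \<longlonglongrightarrow> F (y - t) * H t"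
          using lim by (rule tendsto_cong[THEN iffD2])
        thus ?thesis using 2 by simp
      next
        case 3
        have "\<forall>\<^sub>F n in sequentially. u n < 2 * t"
          using order_tendstoD(2)[OF u, of "2 * t"] 3 by auto
        hence "\<forall>\<^sub>F n in sequentially. indicator {..u n / 2} t * (F (u n - t) * H t) = 0"
          by eventually_elim auto
        thus ?thesis using 3 by (simp add: tendsto_eventually)
      qed
    qed
  qed auto
qed

text \<open>Reflection \<open>t \<mapsto> y - t\<close> carries \<open>{y / 2..}\<close> to
  \<open>{..y / 2}\<close> and exchanges the factors, so both halves have the shape treated in
  \<open>half_conv_tendsto\<close>.\<close>

lemma conv_eq_halves:
  assumes F: "F \<in> kernels X" and H: "H \<in> kernels X"
  shows "conv F H y = (\<integral>t. indicator {..y / 2} t * (F (y - t) * H t) \<partial>lborel)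
    + (\<integral>t. indicator {..y / 2} t * (H (y - t) * F t) \<partial>lborel)"
proof -
  note [measurable] = kernelsD(5)[OF F] kernelsD(5)[OF H]
  have i: "integrable lborel (\<lambda>t. indicator A t * (F (y - t) * H t))" if "A \<in> sets borel" for A
    using integrable_mult_indicator[OF _ conv_integrable[OF F H, of y], of A] that by simp
  have "(\<integral>t. indicator {..y / 2} t * (H (y - t) * F t) \<partial>lborel)
      = (\<integral>t. indicator {y / 2..} t * (F (y - t) * H t) \<partial>lborel)"
    using integral_reflect[of "\<lambda>t. indicator {..y / 2} t * (H (y - t) * F t)" y]
    by (auto simp: mult.commute indicator_def intro!: Bochner_Integration.integral_cong)
  moreover have "conv F H y = (\<integral>t. indicator {..y / 2} t * (F (y - t) * H t)
      + indicator {y / 2..} t * (F (y - t) * H t) \<partial>lborel)"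
    unfolding conv_def
  proof (rule integral_cong_AE)
    show "AE t in lborel. F (y - t) * H t = indicator {..y / 2} t * (F (y - t) * H t)
        + indicator {y / 2..} t * (F (y - t) * H t)"
      using AE_lborel_singleton[of "y/2"] by eventually_elim (auto simp: indicator_def)
  qed measurable
  ultimately show ?thesis using i by simp
qed

text \<open>\<open>half_conv_tendsto\<close> needs a positive lower bound on the arguments, so
  continuity is first shown on each \<open>{d..X}\<close>; near \<open>y\<close> the sets
  \<open>{0<..X}\<close> and \<open>{y/2..X}\<close> coincide.\<close>

lemma continuous_on_conv:
  assumes F: "F \<in> kernels X" and H: "H \<in> kernels X"
  shows "continuous_on {0<..X} (conv F H)"
proof -
  have *: "continuous_on {d..X} (conv F H)" if "0 < d" for d
  proof (rule continuous_on_sequentiallyI)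
    fix u y assume "\<forall>n. u n \<in> {d..X}" "y \<in> {d..X}" "u \<longlonglongrightarrow> y"
    thus "(\<lambda>n. conv F H (u n)) \<longlonglongrightarrow> conv F H y"
      unfolding conv_eq_halves[OF F H] using that
      by (intro tendsto_add half_conv_tendsto[OF F H] half_conv_tendsto[OF H F]) auto
  qed
  show ?thesis
    unfolding continuous_on_eq_continuous_within
  proof
    fix y assume y: "y \<in> {0<..X}"
    have "at y within {0<..X} = at y within {y/2..X}"
      by (rule at_within_nhd[of y "{y/2<..}"]) (use y in auto)
    thus "continuous (at y within {0<..X}) (conv F H)"
      using *[of "y/2"] y by (simp add: continuous_on_eq_continuous_within)
  qed
qed

section \<open>Fubini: closure under convolution and associativity\<close>

lemma conv_integrable_pair:
  fixes F H :: "real \<Rightarrow> real"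
  assumes F: "integrable lborel F" and H: "integrable lborel H"
  shows "integrable (lborel \<Otimes>\<^sub>M lborel) (\<lambda>(t, s). F (s - t) * H t)"
proof (rule lborel_pair.Fubini_integrable)
  have [measurable]: "F \<in> borel_measurable borel" "H \<in> borel_measurable borel"
    using F H by auto
  show "(\<lambda>(t, s). F (s - t) * H t) \<in> borel_measurable (lborel \<Otimes>\<^sub>M lborel)" by measurable
  \<comment> \<open>By translation invariance the inner integral of the absolute value is the L1
    norm of \<open>F\<close> times \<open>\<bar>H t\<bar>\<close>: the L1 case of Young's
    inequality.\<close>
  have shift: "integrable lborel (\<lambda>s. F (s - t))"
      "(\<integral>s. \<bar>F (s - t)\<bar> \<partial>lborel) = (\<integral>s. \<bar>F s\<bar> \<partial>lborel)" for t
    using lborel_integrable_real_affine[OF F, of 1 "- t"]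
      lborel_integral_real_affine[of 1 "\<lambda>s. \<bar>F s\<bar>" "- t"] by (simp_all add: add.commute)
  show "integrable lborel (\<lambda>t. \<integral>s. norm (case (t, s) of (t, s) \<Rightarrow> F (s - t) * H t) \<partial>lborel)"
    using H by (simp add: abs_mult shift)
  show "AE t in lborel. integrable lborel (\<lambda>s. case (t, s) of (t, s) \<Rightarrow> F (s - t) * H t)"
    using shift by (intro AE_I2) simp
qed

text \<open>The convolution of two functions supported in \<open>{0<..X}\<close> can reach up to
  \<open>2 * X\<close>, hence the truncation.\<close>

lemma kernels_conv:
  assumes F: "F \<in> kernels X" and H: "H \<in> kernels X"
  shows "trunc X (conv F H) \<in> kernels X"
proof -
  have "integrable lborel (conv F H)"
    using lborel_pair.integrable_snd[OF conv_integrable_pair[OF kernelsD(1)[OF F] kernelsD(1)[OF H]]]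
    by (simp add: conv_def[abs_def])
  hence "integrable lborel (trunc X (conv F H))"
    using integrable_mult_indicator[of "{0<..X}" lborel "conv F H"] by (simp add: trunc_def[abs_def])
  moreover have "continuous_on {0<..X} (trunc X (conv F H))"
    by (rule continuous_on_eq[OF continuous_on_conv[OF F H]]) (auto simp: trunc_def)
  ultimately show ?thesis by (auto simp: kernels_def trunc_def)
qed

text \<open>Causality: \<open>F (y - t)\<close> vanishes for \<open>t \<ge> y\<close>, so with
  \<open>y \<le> X\<close> the values of \<open>H\<close> beyond \<open>X\<close> are never
  seen.\<close>

lemma conv_trunc_right:
  assumes "\<And>t. t \<le> 0 \<Longrightarrow> F t = 0" "\<And>t. t \<le> 0 \<Longrightarrow> H t = 0" "y \<le> X"
  shows "conv F (trunc X H) y = conv F H y"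
  unfolding conv_def trunc_def
proof (rule Bochner_Integration.integral_cong[OF refl])
  fix t
  show "F (y - t) * (indicator {0<..X} t * H t) = F (y - t) * H t"
    using assms(1)[of "y - t"] assms(2)[of t] assms(3) by (cases "t \<in> {0<..X}") auto
qed

lemma conv_eq_0:
  assumes F: "F \<in> kernels X" and H: "H \<in> kernels X" and "y \<le> 0"
  shows "conv F H y = 0"
proof -
  have *: "F (y - t) * H t = 0" for t
    using kernelsD(3)[OF F, of "y - t"] kernelsD(3)[OF H, of t] assms(3) by (cases "t \<le> 0") auto
  show ?thesis unfolding conv_def * by simp
qed

text \<open>Fubini at a fixed \<open>y\<close>. Absolute integrability comes from
  \<open>conv_integrable\<close> for the absolute values, whose truncated convolution is again in
  the class; hence no exceptional null set of \<open>y\<close>.\<close>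

lemma conv_assoc:
  assumes F: "F \<in> kernels X" and H: "H \<in> kernels X" and J: "J \<in> kernels X" and y: "y \<le> X"
  shows "conv F (conv H J) y = conv (conv F H) J y"
proof -
  note [measurable] = kernelsD(5)[OF F] kernelsD(5)[OF H] kernelsD(5)[OF J]
  have int: "integrable (lborel \<Otimes>\<^sub>M lborel) (\<lambda>(s, t). F (y - s) * (H (s - t) * J t))"
  proof (rule lborel_pair.Fubini_integrable)
    show "(\<lambda>(s, t). F (y - s) * (H (s - t) * J t)) \<in> borel_measurable (lborel \<Otimes>\<^sub>M lborel)"
      by measurable
    let ?H = "\<lambda>t. \<bar>H t\<bar>" and ?J = "\<lambda>t. \<bar>J t\<bar>" and ?F = "\<lambda>t. \<bar>F t\<bar>"
    have k: "?H \<in> kernels X" "?J \<in> kernels X" "?F \<in> kernels X"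
      using F H J by (auto intro: kernels_abs)
    have eq: "?F (y - s) * trunc X (conv ?H ?J) s = (\<integral>t. norm (F (y - s) * (H (s - t) * J t)) \<partial>lborel)" for s
    proof -
      \<comment> \<open>For \<open>s > X\<close> the factor \<open>F (y - s)\<close> is 0 because
        \<open>y \<le> X\<close>; for \<open>s \<le> 0\<close> the convolution itself is 0. So the
        truncation changes nothing.\<close>
      have "?F (y - s) * trunc X (conv ?H ?J) s = ?F (y - s) * conv ?H ?J s"
        using conv_eq_0[OF k(1,2), of s] kernelsD(3)[OF F, of "y - s"] y
        by (cases "s \<in> {0<..X}") (auto simp: trunc_def)
      thus ?thesis by (simp add: conv_def abs_mult)
    qed
    show "integrable lborel (\<lambda>s. \<integral>t. norm (case (s, t) of (s, t) \<Rightarrow> F (y - s) * (H (s - t) * J t)) \<partial>lborel)"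
      using conv_integrable[OF k(3) kernels_conv[OF k(1,2)], of y] unfolding eq by simp
    show "AE s in lborel. integrable lborel (\<lambda>t. case (s, t) of (s, t) \<Rightarrow> F (y - s) * (H (s - t) * J t))"
      using conv_integrable[OF H J] by (intro AE_I2) simp
  qed
  have "conv F (conv H J) y = (\<integral>s. \<integral>t. F (y - s) * (H (s - t) * J t) \<partial>lborel \<partial>lborel)"
    by (simp add: conv_def)
  also have "\<dots> = (\<integral>t. \<integral>s. F (y - s) * (H (s - t) * J t) \<partial>lborel \<partial>lborel)"
    by (rule lborel_pair.Fubini_integral[OF int, symmetric])
  also have "\<dots> = (\<integral>t. conv F H (y - t) * J t \<partial>lborel)"
  proof (rule Bochner_Integration.integral_cong[OF refl])
    fix t
    have "(\<integral>s. F (y - s) * (H (s - t) * J t) \<partial>lborel) = (\<integral>s. F (y - s) * H (s - t) \<partial>lborel) * J t"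
      by (simp flip: mult.assoc)
    also have "(\<integral>s. F (y - s) * H (s - t) \<partial>lborel) = conv F H (y - t)"
      using lborel_integral_real_affine[of 1 "\<lambda>s. F (y - s) * H (s - t)" t]
      by (simp add: conv_def algebra_simps)
    finally show "(\<integral>s. F (y - s) * (H (s - t) * J t) \<partial>lborel) = conv F H (y - t) * J t" .
  qed
  finally show ?thesis by (simp add: conv_def)
qed

lemma conv_add_right:
  assumes "F \<in> kernels X" "H \<in> kernels X" "J \<in> kernels X"
  shows "conv F (\<lambda>t. c * H t + J t) y = c * conv F H y + conv F J y"
proof -
  have "conv F (\<lambda>t. c * H t + J t) y = (\<integral>t. c * (F (y - t) * H t) + F (y - t) * J t \<partial>lborel)"
    by (simp add: conv_def algebra_simps)
  also have "\<dots> = c * conv F H y + conv F J y"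
    unfolding conv_def using conv_integrable assms
    by (subst Bochner_Integration.integral_add) auto
  finally show ?thesis .
qed

section \<open>Convolution with the constant one as integration from 0\<close>

lemma conv_one_eq_integral:
  assumes F: "F \<in> kernels X" and y: "0 \<le> y" "y \<le> X"
  shows "conv (trunc X (\<lambda>_. 1)) F y = integral {0..y} F" "F integrable_on {0..y}"
proof -
  have s: "set_integrable lborel {0..y} F"
    using integrable_mult_indicator[of "{0..y}" lborel F] kernelsD(1)[OF F]
    by (simp add: set_integrable_def)
  have "conv (trunc X (\<lambda>_. 1)) F y = (LINT t:{0..y}|lborel. F t)"
    unfolding conv_def set_lebesgue_integral_def
  proof (rule integral_cong_AE)
    \<comment> \<open>At \<open>t = y\<close> the truncated one is evaluated at 0, where it is 0,
      while the indicator of \<open>{0..y}\<close> is 1.\<close>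
    show "AE t in lborel. trunc X (\<lambda>_. 1) (y - t) * F t = indicator {0..y} t *\<^sub>R F t"
      using AE_lborel_singleton[of y]
    proof eventually_elim
      case (elim t)
      thus ?case
        using kernelsD(3)[OF F, of t] y by (auto simp: trunc_def indicator_def not_le)
    qed
  qed (use kernelsD(5)[OF F] kernelsD(5)[OF kernels_one[of X]] in measurable)
  thus "conv (trunc X (\<lambda>_. 1)) F y = integral {0..y} F" "F integrable_on {0..y}"
    using set_borel_integral_eq_integral[OF s] by auto
qed

text \<open>Fundamental theorem of calculus at an interior point, where \<open>F\<close> is
  continuous; at 0 integrability is enough.\<close>

lemma conv_one_has_derivative:
  assumes F: "F \<in> kernels X" and y: "0 < y" "y < X"
  shows "(conv (trunc X (\<lambda>_. 1)) F has_real_derivative F y) (at y)"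
proof -
  have "continuous_on {0<..<X} F"
    by (rule continuous_on_subset[OF kernelsD(2)[OF F]]) auto
  hence "continuous (at y) F" using y by (simp add: continuous_on_eq_continuous_at)
  \<comment> \<open>The removed set is the exceptional set in
    \<open>integral_has_vector_derivative_continuous_at\<close>, here empty.\<close>
  hence "continuous (at y within ({0..X} - {})) F" by (rule continuous_at_imp_continuous_at_within)
  hence "((\<lambda>u. integral {0..u} F) has_vector_derivative F y) (at y within ({0..X} - {}))"
    using conv_one_eq_integral(2)[OF F, of X] y
    by (intro integral_has_vector_derivative_continuous_at) auto
  hence "((\<lambda>u. integral {0..u} F) has_real_derivative F y) (at y)"
    using y at_within_interior[of y "{0..X}"] by (simp add: has_real_derivative_iff_has_vector_derivative)
  thus ?thesis
    by (rule has_field_derivative_transform_within_open[of _ _ _ "{0<..<X}"])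
       (use y conv_one_eq_integral(1)[OF F] in auto)
qed

section \<open>Interval integrals, power bounds and membership in the kernel class\<close>

lemma conv_trunc_eq_LBINT:
  assumes "y \<le> X"
  shows "conv (trunc X F) (trunc X H) y = (LBINT t:{0<..<y}. F (y - t) * H t)"
  unfolding conv_def set_lebesgue_integral_def trunc_def
proof (rule Bochner_Integration.integral_cong[OF refl])
  fix t
  show "indicator {0<..X} (y - t) * F (y - t) * (indicator {0<..X} t * H t) =
      indicator {0<..<y} t *\<^sub>R (F (y - t) * H t)"
    using assms by (cases "0 < t \<and> t < y") auto
qed

text \<open>Open intervals are what the substitution delivers; the endpoint \<open>X\<close> is a
  null set.\<close>

lemma kernels_truncI:
  assumes "set_integrable lborel {0<..<X} F" "continuous_on {0<..X} F"
  shows "trunc X F \<in> kernels X"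
proof -
  have m: "trunc X F \<in> borel_measurable borel"
    using borel_measurable_continuous_on_indicator[OF _ assms(2)] by (simp add: trunc_def[abs_def])
  have "integrable lborel (trunc X F)"
  proof (subst integrable_cong_AE)
    show "integrable lborel (\<lambda>t. indicator {0<..<X} t *\<^sub>R F t)"
      using assms(1) by (simp add: set_integrable_def)
    thus "(\<lambda>t. indicator {0<..<X} t *\<^sub>R F t) \<in> borel_measurable lborel" by simp
    show "AE t in lborel. trunc X F t = indicator {0<..<X} t *\<^sub>R F t"
      using AE_lborel_singleton[of X] by eventually_elim (auto simp: trunc_def indicator_def)
  qed (use m in simp)
  moreover have "continuous_on {0<..X} (trunc X F)"
    by (rule continuous_on_eq[OF assms(2)]) (auto simp: trunc_def)
  ultimately show ?thesis by (auto simp: kernels_def trunc_def)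
qed

lemma kernels_powr_bound:
  assumes "0 \<le> X" "p > -1" "continuous_on {0<..X} F"
    and bound: "\<And>t. 0 < t \<Longrightarrow> t \<le> X \<Longrightarrow> \<bar>F t\<bar> \<le> C * t powr p"
  shows "trunc X F \<in> kernels X"
proof (rule kernels_truncI)
  have "(\<lambda>t. t powr p) absolutely_integrable_on {0<..X}"
    using integrable_on_powr_from_0'[of p X] assms by (intro nonnegative_absolutely_integrable_1) auto
  \<comment> \<open>\<open>absolutely_integrable_on\<close> refers to Lebesgue measure; for a Borel
    measurable integrand \<open>integrable_completion\<close> passes to
    \<open>lborel\<close>.\<close>
  hence i: "integrable lborel (\<lambda>t. indicator {0<..X} t *\<^sub>R t powr p)"
    by (subst (asm) set_integrable_def, subst (asm) integrable_completion) auto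
  have "integrable lborel (\<lambda>t. indicator {0<..X} t *\<^sub>R F t)"
  proof (rule Bochner_Integration.integrable_bound)
    show "integrable lborel (\<lambda>t. C * (indicator {0<..X} t *\<^sub>R t powr p))"
      using i by (rule integrable_mult_right)
    show "(\<lambda>t. indicator {0<..X} t *\<^sub>R F t) \<in> borel_measurable lborel"
      using borel_measurable_continuous_on_indicator[OF _ assms(3)] by simp
    show "AE t in lborel. norm (indicator {0<..X} t *\<^sub>R F t) \<le> norm (C * (indicator {0<..X} t *\<^sub>R t powr p))"
    proof (rule AE_I2)
      fix t
      show "norm (indicator {0<..X} t *\<^sub>R F t) \<le> norm (C * (indicator {0<..X} t *\<^sub>R t powr p))"
        using bound[of t] by (cases "t \<in> {0<..X}") auto
    qed
  qed
  hence "set_integrable lborel {0<..X} F" by (simp add: set_integrable_def)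
  thus "set_integrable lborel {0<..<X} F" by (rule set_integrable_subset) auto
qed fact

lemma C_minus1_continuous:
  assumes "F \<in> C_minus1 l"
  shows "continuous_on {0<..l} F"
proof -
  obtain p G where G: "continuous_on {0..l} G" "\<forall>x\<in>{0<..l}. F x = x powr p * G x"
    using assms unfolding C_minus1_def by blast
  have "continuous_on {0<..l} (\<lambda>x. x powr p * G x)"
    by (intro continuous_intros continuous_on_subset[OF G(1)]) auto
  thus ?thesis by (rule continuous_on_eq) (use G(2) in auto)
qed

lemma C_minus1_kernels:
  assumes F: "F \<in> C_minus1 l" and X: "0 \<le> X" "X \<le> l"
  shows "trunc X F \<in> kernels X"
proof -
  obtain p G where G: "p > -1" "continuous_on {0..l} G" "\<forall>x\<in>{0<..l}. F x = x powr p * G x"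
    using F unfolding C_minus1_def by blast
  have "bounded (G ` {0..l})" using G(2) by (intro compact_imp_bounded compact_continuous_image) auto
  then obtain B where "\<forall>z\<in>G ` {0..l}. norm z \<le> B" unfolding bounded_iff by blast
  hence B: "\<And>t. t \<in> {0..l} \<Longrightarrow> \<bar>G t\<bar> \<le> B" by simp
  show ?thesis
  proof (rule kernels_powr_bound[OF X(1) G(1)])
    show "continuous_on {0<..X} F"
      by (rule continuous_on_subset[OF C_minus1_continuous[OF F]]) (use X in auto)
    fix t assume t: "0 < t" "t \<le> X"
    have "\<bar>F t\<bar> = \<bar>G t\<bar> * t powr p" using bspec[OF G(3), of t] t X by (simp add: abs_mult)
    also have "\<dots> \<le> B * t powr p" using B[of t] t X by (intro mult_right_mono) auto
    finally show "\<bar>F t\<bar> \<le> B * t powr p" .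
  qed
qed

text \<open>The algebraic core after substitution. \<open>X\<close> is the image of the evaluation
  point, so the last equation is stated there; the derivative is taken at interior points, which
  determine the later integral.\<close>

lemma sonin_inversion:
  fixes c :: real
  assumes M: "M \<in> kernels X" and K: "K \<in> kernels X" and H: "H \<in> kernels X"
    and sonin: "\<And>y. y \<in> {0<..X} \<Longrightarrow> conv M K y = 1" and X: "0 < X"
  defines "h \<equiv> trunc X (\<lambda>t. c + conv (trunc X (\<lambda>_. 1)) H t)"
    and "\<psi> \<equiv> \<lambda>t. c * M t + trunc X (conv M H) t"
  shows "\<psi> \<in> kernels X"
    and "\<And>y. 0 < y \<Longrightarrow> y < X \<Longrightarrow> (conv M h has_real_derivative \<psi> y) (at y)"
    and "conv K \<psi> X = h X"
proof -
  let ?one = "trunc X (\<lambda>_. 1)"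
  note one = kernels_one[of X]
  note oneH = kernels_conv[OF one H] and MH = kernels_conv[OF M H]
  have h_eq: "h = (\<lambda>t. c * ?one t + trunc X (conv ?one H) t)"
    by (auto simp: h_def trunc_def fun_eq_iff indicator_def)
  show psi: "\<psi> \<in> kernels X" unfolding \<psi>_def by (intro kernels_add kernels_cmult M MH)
  \<comment> \<open>Up to \<open>X\<close> the inner truncation is invisible, so associativity
    applies.\<close>
  have trunc: "conv F (trunc X (conv G H)) y = conv (conv F G) H y"
    if "F \<in> kernels X" "G \<in> kernels X" "y \<le> X" for F G y
  proof -
    have "conv F (trunc X (conv G H)) y = conv F (conv G H) y"
      by (rule conv_trunc_right) (use that H in \<open>auto intro: kernelsD(3) conv_eq_0\<close>)
    thus ?thesis using conv_assoc[OF that(1,2) H that(3)] by simp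
  qed
  \<comment> \<open>The equality includes \<open>y \<le> 0\<close>, so it holds on the open set
    \<open>{..<X}\<close> and can transfer the derivative.\<close>
  have eq: "conv M h y = conv ?one \<psi> y" if "y \<le> X" for y
  proof -
    \<comment> \<open>An equality of functions, in order to rewrite inside the outer
      convolution.\<close>
    have comm: "conv M ?one = conv ?one M" by (intro ext) (rule conv_commute)
    have "conv M h y = c * conv M ?one y + conv (conv M ?one) H y"
      unfolding h_eq using that by (simp add: conv_add_right[OF M one oneH] trunc M one)
    also have "\<dots> = c * conv ?one M y + conv (conv ?one M) H y" by (simp only: comm)
    also have "\<dots> = conv ?one \<psi> y"
      unfolding \<psi>_def using that by (simp add: conv_add_right[OF one M MH] trunc M one)
    finally show ?thesis .
  qed
  show "(conv M h has_real_derivative \<psi> y) (at y)" if "0 < y" "y < X" for y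
    by (rule has_field_derivative_transform_within_open[OF conv_one_has_derivative[OF psi that], of "{..<X}"])
       (use that eq in auto)
  have one_KM: "trunc X (conv K M) = ?one"
    using sonin unfolding conv_commute[of K M] by (auto simp: trunc_def fun_eq_iff indicator_def)
  have "conv K \<psi> X = c * conv K M X + conv (conv K M) H X"
    unfolding \<psi>_def by (simp add: conv_add_right[OF K M MH] trunc K M)
  also have "conv K M X = 1" using sonin[of X] X conv_commute[of K M X] by simp
  \<comment> \<open>With \<open>conv K M\<close> on the right, \<open>conv_trunc_right\<close>
    replaces it by its truncation, which \<open>one_KM\<close> identifies with the constant
    one.\<close>
  also have "conv (conv K M) H X = conv H (trunc X (conv K M)) X"
    unfolding conv_commute[of "conv K M" H]
    by (rule conv_trunc_right[symmetric]) (use kernelsD(3)[OF H] conv_eq_0[OF K M] in auto)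
  also have "\<dots> = conv ?one H X" unfolding one_KM by (rule conv_commute)
  finally show "conv K \<psi> X = h X" using X by (simp add: h_def trunc_def)
qed

subsection \<open>Substitution by an increasing function\<close>

text \<open>Continuity on open intervals gives Borel measurability, which links the change of
  variables for Lebesgue measure to \<open>lborel\<close>. The integrability equivalence later
  yields a kernel from the derivative of \<open>f\<close>.\<close>

lemma lborel_substitution:
  fixes d d' F :: "real \<Rightarrow> real"
  assumes inj: "inj_on d {a<..<x}" and img: "d ` {a<..<x} = {y<..<z}"
    and der: "\<And>u. u \<in> {a<..<x} \<Longrightarrow> (d has_real_derivative d' u) (at u)"
    and nonneg: "\<And>u. u \<in> {a<..<x} \<Longrightarrow> d' u \<ge> 0"
    and d': "continuous_on {a<..<x} d'" and F: "continuous_on {y<..<z} F"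
  shows "set_integrable lborel {a<..<x} (\<lambda>u. F (d u) * d' u) \<longleftrightarrow> set_integrable lborel {y<..<z} F" (is ?A)
    and "(LBINT u:{a<..<x}. F (d u) * d' u) = (LBINT t:{y<..<z}. F t)" (is ?B)
proof -
  let ?f = "\<lambda>u. F (d u) * d' u"
  have d: "continuous_on {a<..<x} d"
    using der by (intro continuous_at_imp_continuous_on) (metis DERIV_isCont)
  have f: "continuous_on {a<..<x} ?f"
    by (intro continuous_intros d' continuous_on_compose2[OF F d]) (use img in auto)
  have compl: "set_integrable lborel S G \<longleftrightarrow> G absolutely_integrable_on S"
    if "continuous_on S G" "open S" for S and G :: "real \<Rightarrow> real"
    using borel_measurable_continuous_on_indicator[OF _ that(1)] that(2)
    by (simp add: set_integrable_def integrable_completion)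
  have cong: "(\<lambda>u. \<bar>d' u\<bar> * F (d u)) absolutely_integrable_on {a<..<x} \<longleftrightarrow> ?f absolutely_integrable_on {a<..<x}"
    by (rule set_integrable_cong) (use nonneg in auto)
  have cong': "integral {a<..<x} (\<lambda>u. \<bar>d' u\<bar> * F (d u)) = integral {a<..<x} ?f"
    by (rule integral_cong) (use nonneg in auto)
  \<comment> \<open>An equivalence for each value \<open>r\<close>, which encodes both integrability
    and equality of the integrals.\<close>
  have cov: "?f absolutely_integrable_on {a<..<x} \<and> integral {a<..<x} ?f = r
      \<longleftrightarrow> F absolutely_integrable_on {y<..<z} \<and> integral {y<..<z} F = r" for r
    using has_absolute_integral_change_of_variables_1'[of "{a<..<x}" d d' F r] inj
      has_field_derivative_at_within[OF der] unfolding cong cong' img by simp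
  have "?f absolutely_integrable_on {a<..<x} \<longleftrightarrow> F absolutely_integrable_on {y<..<z}"
    using cov by blast
  thus A: ?A using compl[OF f] compl[OF F] by simp
  show ?B
  proof (cases "set_integrable lborel {y<..<z} F")
    case True
    thus ?thesis using A set_borel_integral_eq_integral(2)[of "{y<..<z}" F] set_borel_integral_eq_integral(2)[of "{a<..<x}" ?f]
        cov[of "integral {y<..<z} F"] compl[OF F, OF open_greaterThanLessThan] by simp
  next
    \<comment> \<open>Without integrability both integrals take the default value 0.\<close>
    case False
    thus ?thesis using A
      by (simp add: set_integrable_def set_lebesgue_integral_def not_integrable_integral_eq)
  qed
qed

text \<open>The right end is the evaluation point \<open>x\<close>, and derivatives within
  \<open>{a..x}\<close> are one-sided at both ends. The right-sided case becomes another instance by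
  reflection.\<close>

locale increasing_C1 =
  fixes a x :: real and g g' :: "real \<Rightarrow> real"
  assumes less: "a < x"
    and mono: "mono_on {a<..<x} g"
    and deriv_within: "\<And>u. u \<in> {a..x} \<Longrightarrow> (g has_real_derivative g' u) (at u within {a..x})"
    and deriv_nonzero: "\<And>u. u \<in> {a..x} \<Longrightarrow> g' u \<noteq> 0"
    and cont_deriv: "continuous_on {a<..x} g'"
begin

lemma cont: "continuous_on {a..x} g"
  using deriv_within by (rule DERIV_continuous_on)

lemma has_deriv: "u \<in> {a<..<x} \<Longrightarrow> (g has_real_derivative g' u) (at u)"
  using deriv_within[of u] by (simp add: at_within_interior[of u "{a..x}"])

lemma deriv_pos: "u \<in> {a<..<x} \<Longrightarrow> 0 < g' u"
  using mono_on_imp_deriv_nonneg[OF mono has_deriv[of u]] deriv_nonzero[of u] by (auto simp: less_le)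

lemma strict:
  assumes "a \<le> u" "u < w" "w \<le> x" shows "g u < g w"
proof (rule DERIV_pos_imp_increasing_open[OF assms(2)])
  show "\<exists>y. (g has_real_derivative y) (at t) \<and> 0 < y" if "u < t" "t < w" for t
    using has_deriv[of t] deriv_pos[of t] that assms by auto
  show "continuous_on {u..w} g" by (rule continuous_on_subset[OF cont]) (use assms in auto)
qed

lemma inj: "inj_on g {a..x}"
proof (rule inj_onI)
  fix u w assume "u \<in> {a..x}" "w \<in> {a..x}" "g u = g w"
  thus "u = w" using strict[of u w] strict[of w u] by (cases u w rule: linorder_cases) auto
qed

lemma image:
  assumes "a < w" "w \<le> x" shows "(\<lambda>u. g u - g a) ` {a<..<w} = {0<..<g w - g a}"
proof (intro equalityI subsetI)
  fix t assume t: "t \<in> {0<..<g w - g a}"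
  have "continuous_on {a..w} g" by (rule continuous_on_subset[OF cont]) (use assms in auto)
  then obtain u where u: "a \<le> u" "u \<le> w" "g u = t + g a"
    using IVT'[of g a "t + g a" w] t assms by auto
  hence "u \<noteq> a" "u \<noteq> w" using t by auto
  thus "t \<in> (\<lambda>u. g u - g a) ` {a<..<w}" using u by (intro image_eqI[of _ _ u]) auto
qed (use strict assms in auto)

lemma substitution:
  assumes w: "a < w" "w \<le> x" and F: "continuous_on {0<..<g w - g a} F"
  shows "set_integrable lborel {a<..<w} (\<lambda>u. F (g u - g a) * g' u) \<longleftrightarrow>
      set_integrable lborel {0<..<g w - g a} F"
    and "(LBINT u:{a<..<w}. F (g u - g a) * g' u) = (LBINT t:{0<..<g w - g a}. F t)"
proof -
  have 1: "inj_on (\<lambda>u. g u - g a) {a<..<w}"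
    by (rule inj_onI, rule inj_onD[OF inj]) (use w in auto)
  have 2: "((\<lambda>u. g u - g a) has_real_derivative g' u) (at u)" "g' u \<ge> 0" if "u \<in> {a<..<w}" for u
    using has_deriv[of u] deriv_pos[of u] that w by (auto intro!: derivative_eq_intros)
  have 3: "continuous_on {a<..<w} g'" by (rule continuous_on_subset[OF cont_deriv]) (use w in auto)
  note sub = lborel_substitution[where d = "\<lambda>u. g u - g a", OF 1 image[OF w] 2 3 F]
  show "set_integrable lborel {a<..<w} (\<lambda>u. F (g u - g a) * g' u) \<longleftrightarrow>
      set_integrable lborel {0<..<g w - g a} F" by (rule sub(1))
  show "(LBINT u:{a<..<w}. F (g u - g a) * g' u) = (LBINT t:{0<..<g w - g a}. F t)"
    by (rule sub(2))
qed

text \<open>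
  Since \<open>g'\<close> need not be continuous at \<open>a\<close>, the bound comes from the difference quotient at \<open>a\<close>,
  extended continuously by \<open>g' a\<close>.
\<close>
lemma linear_lower_bound:
  obtains c where "0 < c" "\<And>u. u \<in> {a..x} \<Longrightarrow> c * (u - a) \<le> g u - g a"
proof -
  define r where "r u = (if u = a then g' a else (g u - g a) / (u - a))" for u
  have "continuous_on {a..x} r"
    unfolding continuous_on_eq_continuous_within
  proof
    fix u assume u: "u \<in> {a..x}"
    show "continuous (at u within {a..x}) r"
    proof (cases "u = a")
      case True
      have "((\<lambda>y. (g y - g a) / (y - a)) \<longlongrightarrow> g' a) (at a within {a..x})"
        using deriv_within[of a] less by (simp add: has_field_derivative_iff)
      hence "(r \<longlongrightarrow> g' a) (at a within {a..x})"
        by (rule Lim_transform_eventually) (auto simp: r_def eventually_at_filter)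
      thus ?thesis using True by (simp add: continuous_within r_def)
    next
      case False
      have "continuous (at u within {a..x}) (\<lambda>u. (g u - g a) / (u - a))"
        using cont u False by (intro continuous_intros) (auto simp: continuous_on_eq_continuous_within)
      moreover have "\<forall>\<^sub>F y in at u within {a..x}. y \<noteq> a"
        using False by (intro eventually_neq_at_within)
      hence "\<forall>\<^sub>F y in at u within {a..x}. (g y - g a) / (y - a) = r y"
        by eventually_elim (simp add: r_def)
      ultimately show ?thesis
        unfolding continuous_within using False by (simp add: r_def Lim_transform_eventually)
    qed
  qed
  hence "continuous_on {a..x} (\<lambda>u. \<bar>r u\<bar>)" by (intro continuous_intros)
  then obtain m where m: "m \<in> {a..x}" "\<And>u. u \<in> {a..x} \<Longrightarrow> \<bar>r m\<bar> \<le> \<bar>r u\<bar>"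
    using continuous_attains_inf[of "{a..x}" "\<lambda>u. \<bar>r u\<bar>"] less by auto
  show thesis
  proof
    \<comment> \<open>At \<open>a\<close> the value is \<open>\<bar>g' a\<bar>\<close>, elsewhere a
      difference quotient of a strictly increasing function. The absolute value avoids determining
      the sign of \<open>g' a\<close>.\<close>
    show "0 < \<bar>r m\<bar>"
      using m(1) strict[of a m] deriv_nonzero[of a] less by (auto simp: r_def)
    fix u assume u: "u \<in> {a..x}"
    show "\<bar>r m\<bar> * (u - a) \<le> g u - g a"
    proof (cases "u = a")
      case False
      thus ?thesis using m(2)[OF u] strict[of a u] u by (auto simp: r_def pos_le_divide_eq)
    qed simp
  qed
qed

text \<open>Integrability is settled in the variable \<open>u\<close>, since the substituted density
  contains \<open>1 / g'\<close>, which may be unbounded near \<open>a\<close>. For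
  \<open>p \<ge> 0\<close> the integrand is bounded; for \<open>p < 0\<close> the linear lower bound
  turns into an upper bound by a multiple of \<open>(u - a) powr p\<close>.\<close>

lemma powr_weight_integrable:
  assumes v: "continuous_on {a..x} v" and p: "p > -1"
  shows "set_integrable lborel {a<..<x} (\<lambda>u. (g u - g a) powr p * v u)"
proof -
  let ?F = "\<lambda>u. (g u - g a) powr p * v u"
  obtain c where c: "0 < c" "\<And>u. u \<in> {a..x} \<Longrightarrow> c * (u - a) \<le> g u - g a"
    using linear_lower_bound by blast
  have "bounded (v ` {a..x})" using v by (intro compact_imp_bounded compact_continuous_image) auto
  then obtain B where "\<forall>z\<in>v ` {a..x}. norm z \<le> B" unfolding bounded_iff by blast
  hence B: "\<And>t. t \<in> {a..x} \<Longrightarrow> \<bar>v t\<bar> \<le> B" by simp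
  have B0: "B \<ge> 0" using B[of a] less by auto
  have bnd: "\<exists>C q. q > -1 \<and> (\<forall>u\<in>{a<..x}. \<bar>?F u\<bar> \<le> C * (u - a) powr q)"
  proof (cases "p \<ge> 0")
    case True
    have "\<bar>?F u\<bar> \<le> (g x - g a) powr p * B * (u - a) powr 0" if "u \<in> {a<..x}" for u
    proof -
      have "g a < g u" "g u \<le> g x" using strict[of a u] strict[of u x] that by (auto simp: le_less)
      thus ?thesis using that B[of u] B0 True by (auto simp: abs_mult intro!: mult_mono powr_mono2)
    qed
    thus ?thesis by (intro exI[of _ "(g x - g a) powr p * B"] exI[of _ 0]) auto
  next
    case False
    have "\<bar>?F u\<bar> \<le> c powr p * B * (u - a) powr p" if "u \<in> {a<..x}" for u
    proof -
      have "(g u - g a) powr p \<le> (c * (u - a)) powr p"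
        using that c False by (intro powr_mono2') auto
      also have "\<dots> = c powr p * (u - a) powr p" using that c by (simp add: powr_mult)
      finally have "(g u - g a) powr p * \<bar>v u\<bar> \<le> c powr p * (u - a) powr p * B"
        using B[of u] that by (intro mult_mono) auto
      thus ?thesis by (simp add: abs_mult mult_ac)
    qed
    thus ?thesis using p by (intro exI[of _ "c powr p * B"] exI[of _ p]) auto
  qed
  then obtain C q where Cq: "q > -1" "\<And>u. u \<in> {a<..x} \<Longrightarrow> \<bar>?F u\<bar> \<le> C * (u - a) powr q" by blast
  have "continuous_on {a<..x} ?F"
    by (intro continuous_intros continuous_on_subset[OF v] continuous_on_subset[OF cont])
       (use strict[of a] in force)+
  \<comment> \<open>A shift by \<open>a\<close> moves the singularity to 0, where
    \<open>kernels_powr_bound\<close> expects it.\<close>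
  hence "continuous_on {0<..x - a} (\<lambda>t. ?F (a + t))"
    by (rule continuous_on_compose2) (auto intro!: continuous_intros)
  hence "trunc (x - a) (\<lambda>t. ?F (a + t)) \<in> kernels (x - a)"
    using Cq(2)[of "a + t" for t] less by (intro kernels_powr_bound[OF _ Cq(1), of _ _ C]) auto
  hence "integrable lborel (\<lambda>u. trunc (x - a) (\<lambda>t. ?F (a + t)) (- a + 1 * u))"
    by (intro lborel_integrable_real_affine kernelsD(1)) auto
  hence "set_integrable lborel {a<..x} ?F"
    unfolding set_integrable_def
    by (rule back_subst[of "integrable lborel"]) (auto simp: trunc_def fun_eq_iff indicator_def)
  thus ?thesis by (rule set_integrable_subset) auto
qed

end

subsection \<open>The Caputo derivative of the fractional integral\<close>

context increasing_C1
begin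

text \<open>The differentiability conclusion serves the reflection argument, which has to compare
  values of \<open>deriv\<close>.\<close>

lemma caputo_left_inverse:
  assumes MK: "(M, K) \<in> Luchko_set l" and l: "g x - g a \<le> l"
    and p: "p > -1" and v: "continuous_on {a..x} v"
    and f: "\<And>u. u \<in> {a<..x} \<Longrightarrow> (f has_real_derivative (g u - g a) powr p * v u) (at u within {a<..x})"
  shows "\<And>u. u \<in> {a<..<x} \<Longrightarrow> gfi_left M g a f differentiable (at u)"
    and "gfd_caputo_left K g a (gfi_left M g a f) x = f x"
proof -
  define d where "d u = g u - g a" for u
  define X where "X = d x"
  define \<phi> where "\<phi> = inv_into {a..x} d"
  \<comment> \<open>Chain rule: the derivative of \<open>f\<close> with respect to
    \<open>t = d u\<close>, read at \<open>u = \<phi> t\<close>.\<close>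
  define H where "H t = t powr p * v (\<phi> t) / g' (\<phi> t)" for t
  let ?f' = "\<lambda>u. d u powr p * v u"
  let ?one = "trunc X (\<lambda>_. 1)"
  have X: "0 < X" "X \<le> l" using strict[of a x] less l by (auto simp: X_def d_def)
  have d_pos: "0 < d u" "d u \<le> X" if "u \<in> {a<..x}" for u
    using strict[of a u] strict[of u x] that by (auto simp: d_def X_def le_less)
  have inj_d: "inj_on d {a..x}" using inj by (auto simp: inj_on_def d_def)
  have cont_d: "continuous_on {a..x} d" unfolding d_def by (intro continuous_intros cont)
  have img: "d ` {a<..<w} = {0<..<d w}" if "a < w" "w \<le> x" for w
    using image[OF that] by (simp add: d_def[abs_def])
  have img_x: "d ` {a<..x} = {0<..X}"
  proof -
    have "{a<..x} = insert x {a<..<x}" "{0<..X} = insert X {0<..<X}" using less X by auto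
    thus ?thesis using img[of x] less by (simp add: X_def)
  qed
  have \<phi>_d: "\<phi> (d u) = u" if "u \<in> {a..x}" for u
    using inv_into_f_f[OF inj_d that] by (simp add: \<phi>_def)
  have \<phi>_in: "\<phi> t \<in> {a<..x}" if t: "t \<in> {0<..X}" for t
  proof -
    obtain u where "u \<in> {a<..x}" "t = d u" using t unfolding img_x[symmetric] by blast
    thus ?thesis using \<phi>_d[of u] by simp
  qed
  have "continuous_on (d ` {a..x}) \<phi>"
    unfolding \<phi>_def by (rule continuous_on_inv[OF cont_d]) (use inv_into_f_f[OF inj_d] in auto)
  moreover have "{0<..X} \<subseteq> d ` {a..x}" unfolding img_x[symmetric] by (rule image_mono) auto
  ultimately have cont_\<phi>: "continuous_on {0<..X} \<phi>" by (rule continuous_on_subset)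
  have "continuous_on {0<..X} (\<lambda>t. v (\<phi> t))"
    by (rule continuous_on_compose2[OF v cont_\<phi>]) (use \<phi>_in in force)
  moreover have "continuous_on {0<..X} (\<lambda>t. g' (\<phi> t))"
    by (rule continuous_on_compose2[OF cont_deriv cont_\<phi>]) (use \<phi>_in in blast)
  moreover have "g' (\<phi> t) \<noteq> 0" if "t \<in> {0<..X}" for t
    using deriv_nonzero[of "\<phi> t"] \<phi>_in[OF that] by simp
  ultimately have cont_H: "continuous_on {0<..X} H"
    unfolding H_def by (intro continuous_intros) auto
  have H_d: "H (d u) * g' u = ?f' u" if "u \<in> {a<..x}" for u
    using \<phi>_d[of u] deriv_nonzero[of u] that by (simp add: H_def)
  have sub: "(LBINT u:{a<..<w}. F (d u) * g' u) = (LBINT t:{0<..<d w}. F t)"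
    "set_integrable lborel {a<..<w} (\<lambda>u. F (d u) * g' u) \<longleftrightarrow> set_integrable lborel {0<..<d w} F"
    if "a < w" "w \<le> x" "continuous_on {0<..<d w} F" for w F
    using substitution[of w F] that unfolding d_def by auto
  have f'_int: "set_integrable lborel {a<..<x} ?f'"
    using powr_weight_integrable[OF v p] by (simp add: d_def)
  hence "set_integrable lborel {a<..<x} (\<lambda>u. H (d u) * g' u)"
    by (subst set_integrable_cong[where f' = ?f']) (auto simp: H_d)
  moreover have "continuous_on {0<..<d x} H"
    by (rule continuous_on_subset[OF cont_H]) (auto simp: X_def)
  ultimately have "set_integrable lborel {0<..<X} H"
    using sub(2)[of x H] less by (simp add: X_def)
  hence H_kernel: "trunc X H \<in> kernels X" using cont_H by (rule kernels_truncI)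

  \<comment> \<open>\<open>c\<close> is the limit of \<open>f\<close> at \<open>a\<close> from the
    right. As \<open>f a\<close> is unconstrained, it is recovered from the value at
    \<open>x\<close>.\<close>
  define c where "c = f x - (LBINT u=ereal a..ereal x. ?f' u)"
  have f_eq: "f w = c + conv ?one (trunc X H) (d w)" if w: "w \<in> {a<..x}" for w
  proof -
    have "conv ?one (trunc X H) (d w) = (LBINT t:{0<..<d w}. H t)"
      using d_pos[OF w] by (simp add: conv_trunc_eq_LBINT)
    also have "\<dots> = (LBINT u:{a<..<w}. H (d u) * g' u)"
      by (rule sub(1)[symmetric])
         (use w d_pos[OF w] in \<open>auto intro: continuous_on_subset[OF cont_H]\<close>)
    also have "\<dots> = (LBINT u:{a<..<w}. ?f' u)"
      by (rule set_lebesgue_integral_cong) (use w H_d in auto)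
    also have "\<dots> = (LBINT u=ereal a..ereal w. ?f' u)"
      using w by (simp add: interval_lebesgue_integral_def)
    finally have 1: "conv ?one (trunc X H) (d w) = (LBINT u=ereal a..ereal w. ?f' u)" .
    have "interval_lebesgue_integrable lborel (min (ereal a) (min (ereal w) (ereal x)))
        (max (ereal a) (max (ereal w) (ereal x))) ?f'"
      using w f'_int by (simp add: interval_lebesgue_integrable_def min_def max_def)
    hence 2: "(LBINT u=ereal a..ereal w. ?f' u) + (LBINT u=ereal w..ereal x. ?f' u)
        = (LBINT u=ereal a..ereal x. ?f' u)"
      by (rule interval_integral_sum)
    \<comment> \<open>The fundamental theorem is applied on \<open>{w..x}\<close>, away from the
      possible singularity at \<open>a\<close>.\<close>
    have "(LBINT u=ereal w..ereal x. ?f' u) = f x - f w"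
    proof (rule interval_integral_FTC_finite)
      have wx: "min w x = w" "max w x = x" using w by auto
      show "continuous_on {min w x..max w x} ?f'"
        unfolding wx
        by (intro continuous_intros continuous_on_subset[OF cont_d] continuous_on_subset[OF v])
           (use w d_pos in \<open>auto simp: less_le\<close>)
      show "(f has_vector_derivative ?f' u) (at u within {min w x..max w x})"
        if "min w x \<le> u" "u \<le> max w x" for u
      proof -
        have "(f has_real_derivative ?f' u) (at u within {a<..x})"
          using f[of u] that w by (simp add: d_def)
        hence "(f has_real_derivative ?f' u) (at u within {w..x})"
          by (rule has_field_derivative_subset) (use w in auto)
        thus ?thesis unfolding wx by (simp only: has_real_derivative_iff_has_vector_derivative)
      qed
    qed
    thus ?thesis using 1 2 by (simp add: c_def)
  qed

  have M: "trunc X M \<in> kernels X" and K: "trunc X K \<in> kernels X"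
    and contM: "continuous_on {0<..l} M" and contK: "continuous_on {0<..l} K"
    using MK X by (auto simp: Luchko_set_def intro!: C_minus1_kernels C_minus1_continuous)
  have sonin: "conv (trunc X M) (trunc X K) y = 1" if "y \<in> {0<..X}" for y
    using MK that X by (auto simp: conv_trunc_eq_LBINT Luchko_set_def interval_lebesgue_integral_def zero_ereal_def)
  define h where "h = (\<lambda>t. c + conv ?one (trunc X H) t)"
  define \<psi> where "\<psi> = (\<lambda>t. c * trunc X M t + trunc X (conv (trunc X M) (trunc X H)) t)"
  have \<psi>: "\<psi> \<in> kernels X"
    unfolding \<psi>_def by (rule sonin_inversion(1)[OF M K H_kernel sonin X(1)])
  have conv_deriv: "(conv (trunc X M) (trunc X h) has_real_derivative \<psi> y) (at y)" if "0 < y" "y < X" for y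
    unfolding h_def \<psi>_def by (rule sonin_inversion(2)[OF M K H_kernel sonin X(1) that])
  have conv_K: "conv (trunc X K) \<psi> X = trunc X h X"
    unfolding h_def \<psi>_def by (rule sonin_inversion(3)[OF M K H_kernel sonin X(1)])
  have cont_h: "continuous_on {0<..X} h"
    unfolding h_def by (intro continuous_intros continuous_on_conv[OF kernels_one H_kernel])
  have deriv_g: "deriv g u = g' u" if "u \<in> {a<..<x}" for u
    using has_deriv[OF that] by (rule DERIV_imp_deriv)
  \<comment> \<open>The kernel argument is a difference, \<open>g w - g u = d w - d u\<close>, so
    the substitution produces a convolution.\<close>
  have gfi: "gfi_left M g a f w = conv (trunc X M) (trunc X h) (d w)" if w: "w \<in> {a<..x}" for w
  proof -
    have "gfi_left M g a f w = (LBINT u:{a<..<w}. M (d w - d u) * h (d u) * g' u)"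
      unfolding gfi_left_def interval_lebesgue_integral_def
      using w f_eq deriv_g by (auto intro!: set_lebesgue_integral_cong simp: d_def h_def)
    also have "\<dots> = (LBINT t:{0<..<d w}. M (d w - t) * h t)"
    proof (rule sub(1))
      show "continuous_on {0<..<d w} (\<lambda>t. M (d w - t) * h t)"
      proof (intro continuous_intros)
        show "continuous_on {0<..<d w} h"
          by (rule continuous_on_subset[OF cont_h]) (use d_pos[OF w] in auto)
        show "continuous_on {0<..<d w} (\<lambda>t. M (d w - t))"
          by (rule continuous_on_compose2[OF contM])
             (use d_pos[OF w] X in \<open>auto intro!: continuous_intros\<close>)
      qed
    qed (use w in auto)
    also have "\<dots> = conv (trunc X M) (trunc X h) (d w)"
      using d_pos[OF w] by (simp add: conv_trunc_eq_LBINT)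
    finally show ?thesis .
  qed
  have gfi_deriv: "(gfi_left M g a f has_real_derivative \<psi> (d u) * g' u) (at u)"
    if u: "u \<in> {a<..<x}" for u
  proof -
    have du: "0 < d u" "d u < X" using d_pos[of u] strict[of u x] u by (auto simp: d_def X_def)
    have "(d has_real_derivative g' u) (at u)"
      unfolding d_def[abs_def] using has_deriv[OF u] by (auto intro!: derivative_eq_intros)
    from DERIV_chain2[OF conv_deriv[OF du] this]
    show ?thesis
      by (rule has_field_derivative_transform_within_open[of _ _ _ "{a<..<x}"]) (use u gfi in auto)
  qed
  thus "gfi_left M g a f differentiable (at u)" if "u \<in> {a<..<x}" for u
    using that real_differentiable_def by blast
  \<comment> \<open>The factor \<open>g' u\<close> from the chain rule in \<open>gfi_deriv\<close>
    is the Jacobian, so the substitution applies a second time.\<close>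
  have "gfd_caputo_left K g a (gfi_left M g a f) x
      = (LBINT u:{a<..<x}. K (X - d u) * \<psi> (d u) * g' u)"
    unfolding gfd_caputo_left_def interval_lebesgue_integral_def
    using less by (auto intro!: set_lebesgue_integral_cong simp: d_def X_def DERIV_imp_deriv[OF gfi_deriv])
  also have "\<dots> = (LBINT t:{0<..<X}. K (X - t) * \<psi> t)"
    unfolding X_def
  proof (rule sub(1))
    show "continuous_on {0<..<d x} (\<lambda>t. K (d x - t) * \<psi> t)"
    proof (intro continuous_intros)
      show "continuous_on {0<..<d x} \<psi>"
        by (rule continuous_on_subset[OF kernelsD(2)[OF \<psi>]]) (auto simp: X_def)
      show "continuous_on {0<..<d x} (\<lambda>t. K (d x - t))"
        by (rule continuous_on_compose2[OF contK])
           (use X in \<open>auto intro!: continuous_intros simp: X_def\<close>)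
    qed
  qed (use less in auto)
  also have "\<dots> = conv (trunc X K) (trunc X \<psi>) X" by (simp add: conv_trunc_eq_LBINT)
  also have "\<dots> = conv (trunc X K) \<psi> X"
    by (rule conv_trunc_right) (use kernelsD(3)[OF K] kernelsD(3)[OF \<psi>] in auto)
  also have "\<dots> = trunc X h X" by (rule conv_K)
  also have "\<dots> = f x" using f_eq[of x] X less by (simp add: trunc_def h_def X_def)
  finally show "gfd_caputo_left K g a (gfi_left M g a f) x = f x" .
qed

end

section \<open>Reflection of the right-sided operators\<close>

lemma gfi_right_reflect:
  assumes "x \<le> b" "\<And>u. u \<in> {x<..<b} \<Longrightarrow> g differentiable (at u)"
  shows "gfi_right M g b f x = gfi_left M (\<lambda>u. - g (- u)) (- b) (\<lambda>u. f (- u)) (- x)"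
proof -
  \<comment> \<open>Where no derivative exists, \<open>deriv\<close> is an unspecified value;
    differentiability of \<open>g\<close> makes both sides comparable.\<close>
  have "deriv (\<lambda>u. - g (- u)) u = deriv g (- u)" if "- b < u" "u < - x" for u
  proof -
    have "(g has_real_derivative deriv g (- u)) (at (- u))"
      using assms(2)[of "- u"] that by (simp add: DERIV_deriv_iff_real_differentiable)
    hence "((\<lambda>u. - g (- u)) has_real_derivative deriv g (- u)) (at u)"
      using DERIV_minus[of "\<lambda>u. g (- u)"] by (fastforce simp: DERIV_mirror)
    thus ?thesis by (rule DERIV_imp_deriv)
  qed
  thus ?thesis
    unfolding gfi_right_def gfi_left_def
    using assms(1)
    by (subst interval_integral_reflect)
       (auto intro!: set_lebesgue_integral_cong simp: interval_lebesgue_integral_def)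
qed

text \<open>The leading minus sign of the right-sided derivative is the one that the chain rule
  produces for \<open>f (- u)\<close>.\<close>

lemma gfd_caputo_right_reflect:
  assumes "x \<le> b" "\<And>u. u \<in> {x<..<b} \<Longrightarrow> f differentiable (at u)"
  shows "gfd_caputo_right K g b f x = gfd_caputo_left K (\<lambda>u. - g (- u)) (- b) (\<lambda>u. f (- u)) (- x)"
proof -
  have "deriv (\<lambda>u. f (- u)) u = - deriv f (- u)" if "- b < u" "u < - x" for u
  proof -
    have "(f has_real_derivative deriv f (- u)) (at (- u))"
      using assms(2)[of "- u"] that by (simp add: DERIV_deriv_iff_real_differentiable)
    hence "((\<lambda>u. f (- u)) has_real_derivative - deriv f (- u)) (at u)"
      by (simp add: DERIV_mirror)
    thus ?thesis by (rule DERIV_imp_deriv)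
  qed
  thus ?thesis
    unfolding gfd_caputo_right_def gfd_caputo_left_def interval_lebesgue_integral_uminus[symmetric]
    using assms(1)
    by (subst interval_integral_reflect)
       (auto intro!: set_lebesgue_integral_cong simp: interval_lebesgue_integral_def)
qed

text \<open>Counterpart of \<open>DERIV_mirror\<close> for derivatives within a set, as they occur
  at endpoints.\<close>

lemma DERIV_within_reflect:
  fixes f :: "real \<Rightarrow> real"
  assumes "(f has_real_derivative D) (at (- u) within S)" "uminus ` T \<subseteq> S"
  shows "((\<lambda>u. f (- u)) has_real_derivative - D) (at u within T)"
proof -
  have "(f has_real_derivative D) (at (- u) within uminus ` T)"
    using assms by (rule has_field_derivative_subset)
  moreover have "(uminus has_real_derivative - 1) (at u within T)"
    by (auto intro!: derivative_eq_intros)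
  ultimately have "(f \<circ> uminus has_real_derivative D * - 1) (at u within T)"
    by (rule DERIV_image_chain)
  thus ?thesis by (simp add: o_def)
qed

section \<open>The two identities for the function classes\<close>

lemma caputo_left:
  assumes MK: "(M, K) \<in> Luchko_set l" and g: "g \<in> G_left a b" and f: "f \<in> C1_left g a b"
    and x: "x \<in> {a<..b}" and l: "g x - g a \<le> l"
  shows "gfd_caputo_left K g a (gfi_left M g a f) x = f x"
proof -
  obtain g' where mono: "mono_on {a<..<b} g"
    and g': "\<forall>x\<in>{a..b}. (g has_real_derivative g' x) (at x within {a..b}) \<and> g' x \<noteq> 0"
      "continuous_on {a<..b} g'"
    using g unfolding G_left_def by blast
  obtain p v where p: "p > -1" and v: "continuous_on {a..b} v"
    and f': "\<forall>x\<in>{a<..b}. (f has_real_derivative (g x - g a) powr p * v x) (at x within {a<..b})"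
    using f unfolding C1_left_def by blast
  \<comment> \<open>Working on \<open>{a..x}\<close> makes \<open>g x - g a\<close> the only length
    that has to stay within \<open>l\<close>.\<close>
  interpret increasing_C1 a x g g'
  proof
    show "a < x" using x by simp
    show "mono_on {a<..<x} g" by (rule mono_on_subset[OF mono]) (use x in auto)
    show "continuous_on {a<..x} g'" by (rule continuous_on_subset[OF g'(2)]) (use x in auto)
    fix u assume "u \<in> {a..x}"
    hence u: "u \<in> {a..b}" using x by auto
    show "g' u \<noteq> 0" using g'(1) u by blast
    have "(g has_real_derivative g' u) (at u within {a..b})" using g'(1) u by blast
    thus "(g has_real_derivative g' u) (at u within {a..x})"
      by (rule has_field_derivative_subset) (use x in auto)
  qed
  show ?thesis
  proof (rule caputo_left_inverse(2)[OF MK l p])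
    show "continuous_on {a..x} v" by (rule continuous_on_subset[OF v]) (use x in auto)
    fix u assume "u \<in> {a<..x}"
    hence "(f has_real_derivative (g u - g a) powr p * v u) (at u within {a<..b})" using f' x by simp
    thus "(f has_real_derivative (g u - g a) powr p * v u) (at u within {a<..x})"
      by (rule has_field_derivative_subset) (use x in auto)
  qed
qed

text \<open>With \<open>?g u = - g (- u)\<close>, which is again increasing,
  \<open>?g u - ?g (- b) = g b - g (- u)\<close>: the right-sided weight becomes the left-sided
  one.\<close>

lemma caputo_right:
  assumes MK: "(M, K) \<in> Luchko_set l" and g: "g \<in> G_right a b" and f: "f \<in> C1_right g a b"
    and x: "x \<in> {a..<b}" and l: "g b - g x \<le> l"
  shows "gfd_caputo_right K g b (gfi_right M g b f) x = f x"
proof -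
  obtain g' where mono: "mono_on {a<..<b} g"
    and g': "\<forall>x\<in>{a..b}. (g has_real_derivative g' x) (at x within {a..b}) \<and> g' x \<noteq> 0"
      "continuous_on {a..<b} g'"
    using g unfolding G_right_def by blast
  obtain q v where q: "q > -1" and v: "continuous_on {a..b} v"
    and f': "\<forall>x\<in>{a..<b}. (f has_real_derivative (g b - g x) powr q * v x) (at x within {a..<b})"
    using f unfolding C1_right_def by blast
  let ?g = "\<lambda>u. - g (- u)" and ?f = "\<lambda>u. f (- u)"
  let ?I = "gfi_left M ?g (- b) ?f"
  interpret increasing_C1 "- b" "- x" ?g "\<lambda>u. g' (- u)"
  proof
    show "- b < - x" using x by simp
    show "mono_on {- b<..<- x} ?g"
      using x by (auto intro!: mono_onI mono_onD[OF mono])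
    show "continuous_on {- b<..- x} (\<lambda>u. g' (- u))"
      by (rule continuous_on_compose2[OF g'(2)]) (use x in \<open>auto intro!: continuous_intros\<close>)
    fix u assume "u \<in> {- b..- x}"
    hence u: "- u \<in> {a..b}" using x by auto
    show "g' (- u) \<noteq> 0" using g'(1) u by blast
    have "(g has_real_derivative g' (- u)) (at (- u) within {a..b})" using g'(1) u by blast
    hence "((\<lambda>u. g (- u)) has_real_derivative - g' (- u)) (at u within {- b..- x})"
      by (rule DERIV_within_reflect) (use x in auto)
    thus "(?g has_real_derivative g' (- u)) (at u within {- b..- x})"
      by (auto intro!: derivative_eq_intros)
  qed
  have l': "?g (- x) - ?g (- b) \<le> l" using l by simp
  \<comment> \<open>The sign that reflection gives to the derivative of \<open>f\<close> is absorbed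
    into the continuous factor.\<close>
  have v': "continuous_on {- b..- x} (\<lambda>u. - v (- u))"
    by (intro continuous_on_minus, rule continuous_on_compose2[OF v])
       (use x in \<open>auto intro!: continuous_intros\<close>)
  have f'': "(?f has_real_derivative (?g u - ?g (- b)) powr q * - v (- u)) (at u within {- b<..- x})"
    if "u \<in> {- b<..- x}" for u
  proof -
    have "(f has_real_derivative (g b - g (- u)) powr q * v (- u)) (at (- u) within {a..<b})"
      using f' that x by simp
    hence "(?f has_real_derivative - ((g b - g (- u)) powr q * v (- u))) (at u within {- b<..- x})"
      by (rule DERIV_within_reflect) (use x in auto)
    thus ?thesis by simp
  qed
  note left = caputo_left_inverse[OF MK l' q v' f'']
  have g_diff: "g differentiable (at u)" if "u \<in> {x<..<b}" for u
  proof -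
    have "(g has_real_derivative g' u) (at u within {a..b})" using g'(1) that x by simp
    hence "(g has_real_derivative g' u) (at u)"
      using that x by (simp add: at_within_interior[of u "{a..b}"])
    thus ?thesis using real_differentiable_def by blast
  qed
  have I_eq: "gfi_right M g b f y = ?I (- y)" if "y \<in> {x..b}" for y
    by (rule gfi_right_reflect) (use that g_diff in auto)
  have I_diff: "gfi_right M g b f differentiable (at u)" if u: "u \<in> {x<..<b}" for u
  proof -
    obtain D where "(?I has_real_derivative D) (at (- u))"
      using left(1)[of "- u"] u by (auto simp: real_differentiable_def)
    hence "((\<lambda>y. ?I (- y)) has_real_derivative - D) (at u)" by (simp add: DERIV_mirror)
    hence "(gfi_right M g b f has_real_derivative - D) (at u)"
      by (rule has_field_derivative_transform_within_open[of _ _ _ "{x<..<b}"]) (use u I_eq in auto)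
    thus ?thesis using real_differentiable_def by blast
  qed
  have "gfd_caputo_right K g b (gfi_right M g b f) x
      = gfd_caputo_left K ?g (- b) (\<lambda>u. gfi_right M g b f (- u)) (- x)"
    by (rule gfd_caputo_right_reflect) (use x I_diff in auto)
  also have "\<dots> = gfd_caputo_left K ?g (- b) ?I (- x)"
  proof -
    \<comment> \<open>Agreement is known on \<open>{- b..- x}\<close>; on its interior this fixes
      the derivative, and the endpoints do not affect the integral.\<close>
    have "deriv (\<lambda>u. gfi_right M g b f (- u)) u = deriv ?I u" if "u \<in> {- b<..<- x}" for u
    proof (rule deriv_cong_ev[OF _ refl])
      have "\<forall>\<^sub>F y in nhds u. y \<in> {- b<..<- x}" using that by (intro eventually_nhds_in_open) auto
      thus "\<forall>\<^sub>F y in nhds u. gfi_right M g b f (- y) = ?I y"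
        by eventually_elim (use I_eq in auto)
    qed
    thus ?thesis
      unfolding gfd_caputo_left_def using x
      by (intro interval_lebesgue_integral_cong) auto
  qed
  also have "\<dots> = f x" using left(2) by simp
  finally show ?thesis .
qed

theorem theorem2:
  fixes a b l :: real and M K f g :: "real \<Rightarrow> real"
  assumes "a < b"
    and "(M, K) \<in> Luchko_set l"
  shows "(g \<in> G_left a b \<and> f \<in> C1_left g a b \<longrightarrow>
            (\<forall>x\<in>{a<..b}. g x - g a \<le> l \<longrightarrow>
               gfd_caputo_left K g a (gfi_left M g a f) x = f x)) \<and>
         (g \<in> G_right a b \<and> f \<in> C1_right g a b \<longrightarrow>
            (\<forall>x\<in>{a..<b}. g b - g x \<le> l \<longrightarrow>
               gfd_caputo_right K g b (gfi_right M g b f) x = f x))"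
  using caputo_left[OF assms(2)] caputo_right[OF assms(2)] by blast

end
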